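(* Suppose that $P(\nu_i>c)\in(0,1)$ for some $c\in\mathbb{R}$ and that $\nu_i$ is independent of $(\alpha_i,\varepsilon_{i1},\varepsilon_{i2},\mu_i,\eta_{i1},\eta_{i2})$. Suppose further that either $P(E[\dot Y_{i2}(0)-\dot Y_{i1}(0)\mid\omega_i]>0)<1$ or $P(E[\dot Y_{i2}(0)-\dot Y_{i1}(0)\mid\omega_i]<0)<1$. Then the following are equivalent: (1) for every selection mechanism $g\in\mathcal{G}_\omega$ such that $G_i=g(\omega_i,\nu_i)$ satisfies $P(G_i=1)\in(0,1)$, parallel trends holds, i.e. $E[Y_{i2}(0)-Y_{i1}(0)\mid G_i=1]=E[Y_{i2}(0)-Y_{i1}(0)\mid G_i=0]$; (2) $E[\dot Y_{i2}(0)-\dot Y_{i1}(0)\mid\omega_i]=0$ almost surely.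
   Context: Units are indexed by $i$ (i.i.d. across $i$; all statements are about a generic unit $i$) and periods by $t\in\{1,2\}$. The unobservables $\alpha_i,\varepsilon_{i1},\varepsilon_{i2}$ are finite-dimensional random vectors, $\mu_i,\eta_{i1},\eta_{i2}$ are additional random vectors, and $\nu_i$ is a scalar random variable. The untreated potential outcomes are real-valued and given by $Y_{it}(0)=\xi_t(\alpha_i,\varepsilon_{it})$, $t=1,2$, for arbitrary (measurable) functions $\xi_t$. All relevant moments are assumed to exist (in particular $E|Y_{it}(0)|<\infty$). Notation: $\dot Y_{it}(0)=Y_{it}(0)-E[Y_{it}(0)]$. The random vector $\omega_i$ is a given (measurable) function or subvector of $(\alpha_i,\varepsilon_{i1},\varepsilon_{i2},\mu_i,\eta_{i1},\eta_{i2})$. Let $\mathcal{O}$ and $\mathcal{V}$ be the supports of $\omega_i$ and $\nu_i$; $\mathcal{G}_\omega$ is the class of all (measurable) functions $g:\mathcal{O}\times\mathcal{V}\to\{0,1\}$, called selection mechanisms, and the treatment-group indicator generated by $g$ is $G_i=g(\omega_i,\nu_i)$. The distribution of the unobservables is held fixed as $g$ varies. *)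

theory Defs
  imports "HOL-Probability.Probability"
begin

definition rv_support :: "'s measure \<Rightarrow> ('s \<Rightarrow> 'x::topological_space) \<Rightarrow> 'x set" where
  "rv_support M X =
     {x. \<forall>U. open U \<and> x \<in> U \<longrightarrow> measure M {s \<in> space M. X s \<in> U} > 0}"

text \<open>
  Two random elements are independent iff the sigma-algebras they generate are independent.
  The library constant \<^const>\<open>prob_space.indep_var\<close> states the same, but forces both random
  elements to have the same codomain type.
\<close>

definition indep_rv ::
    "'s measure \<Rightarrow> ('s \<Rightarrow> 'x::topological_space) \<Rightarrow> ('s \<Rightarrow> 'y::topological_space) \<Rightarrow> bool" where
  "indep_rv M X Y \<longleftrightarrow>
     prob_space.indep_set M
       (sets (vimage_algebra (space M) X borel))
       (sets (vimage_algebra (space M) Y borel))"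

definition cond_exp_given ::
    "'s measure \<Rightarrow> ('s \<Rightarrow> 'x::topological_space) \<Rightarrow> ('s \<Rightarrow> real) \<Rightarrow> 's \<Rightarrow> real" where
  "cond_exp_given M X f = real_cond_exp M (vimage_algebra (space M) X borel) f"

definition cond_exp_event :: "'s measure \<Rightarrow> 's set \<Rightarrow> ('s \<Rightarrow> real) \<Rightarrow> real" where
  "cond_exp_event M A f = (LINT s:A|M. f s) / measure M A"

definition demean :: "'s measure \<Rightarrow> ('s \<Rightarrow> real) \<Rightarrow> 's \<Rightarrow> real" where
  "demean M f = (\<lambda>s. f s - (LINT r|M. f r))"

definition selection_mechanisms ::
    "'x::topological_space set \<Rightarrow> 'y::topological_space set \<Rightarrow> ('x \<times> 'y \<Rightarrow> nat) set" where
  "selection_mechanisms SX SY =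
     measurable (restrict_space borel (SX \<times> SY)) (count_space {0, 1})"

text \<open>
  A selection mechanism carries information only on the product of the two supports, which the
  pair of random elements may leave on a null set. There the group indicator is set to \<open>0\<close>, so
  that the values of the (total) HOL function \<open>g\<close> outside its domain are irrelevant.
\<close>

definition group_indicator ::
    "'s measure \<Rightarrow> ('s \<Rightarrow> 'x::topological_space) \<Rightarrow> ('s \<Rightarrow> 'y::topological_space)
       \<Rightarrow> ('x \<times> 'y \<Rightarrow> nat) \<Rightarrow> 's \<Rightarrow> nat" where
  "group_indicator M X Y g s =
     (if (X s, Y s) \<in> rv_support M X \<times> rv_support M Y then g (X s, Y s) else 0)"

definition parallel_trends ::
    "'s measure \<Rightarrow> ('s \<Rightarrow> real) \<Rightarrow> ('s \<Rightarrow> real) \<Rightarrow> ('s \<Rightarrow> nat) \<Rightarrow> bool" where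
  "parallel_trends M Y1 Y2 G \<longleftrightarrow>
     cond_exp_event M {s \<in> space M. G s = 1} (\<lambda>s. Y2 s - Y1 s) =
     cond_exp_event M {s \<in> space M. G s = 0} (\<lambda>s. Y2 s - Y1 s)"

end

theory Submission
  imports Defs
begin

text \<open>
  Let $D$ be the difference of the demeaned outcomes. As $E D = 0$, parallel trends for $G$ says that
  $E[D; G = 1] = 0$. Since $\nu$ is independent of everything that determines $D$ and $\omega$,
  integrating $\nu$ out gives $E[D; (\omega, \nu) \in B] = E[D \varphi(\omega)]$ with
  $\varphi(w) = P((w, \nu) \in B)$, and this equals $E[E[D \mid \omega]\, \varphi(\omega)]$. So
  $E[D \mid \omega] = 0$ yields parallel trends. Conversely, the mechanism $1\{w \in A, v > c\}$ has
  $\varphi = P(\nu > c) 1_A$ and a nondegenerate group whenever $P(\omega \in A) > 0$, so parallel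
  trends forces $E[D; \omega \in A] = 0$ for all Borel $A$.
\<close>

section \<open>Topological supports\<close>

lemma closed_rv_support: "closed (rv_support M X)"
proof -
  have "- rv_support M X = \<Union>{U. open U \<and> \<not> measure M {s \<in> space M. X s \<in> U} > 0}"
    unfolding rv_support_def by blast
  then have "open (- rv_support M X)"
    by auto
  then show ?thesis
    by (simp add: closed_def)
qed

text \<open>The complement of the support is a union of open null sets, possibly uncountably many.
  In a second countable space the Lindelof property extracts a countable subfamily with the same
  union, so the complement is itself null. Hence the default value of \<open>group_indicator\<close>
  off the supports matters only on a null set.\<close>

lemma (in prob_space) AE_rv_support:
  fixes X :: "'a \<Rightarrow> 'x::second_countable_topology"
  assumes X[measurable]: "X \<in> borel_measurable M"
  shows "AE s in M. X s \<in> rv_support M X"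
proof -
  let ?F = "{U. open U \<and> \<not> measure M {s \<in> space M. X s \<in> U} > 0}"
  obtain F' where F': "F' \<subseteq> ?F" "countable F'" "\<Union>F' = \<Union>?F"
    using Lindelof[of ?F] by blast
  have "AE s in M. \<forall>U\<in>F'. X s \<notin> U"
  proof (subst AE_ball_countable[OF F'(2)], rule ballI)
    fix U assume "U \<in> F'"
    then have U: "open U" "measure M {s \<in> space M. X s \<in> U} = 0"
      using F'(1) by (auto simp: not_less measure_le_0_iff)
    have [measurable]: "U \<in> sets borel"
      using U by auto
    have "{s \<in> space M. X s \<in> U} \<in> sets M"
      by measurable
    then show "AE s in M. X s \<notin> U"
      using U(2) by (subst AE_iff_measurable[OF _ refl]) (auto simp: emeasure_eq_measure)
  qed
  moreover have "x \<in> rv_support M X" if "\<forall>U\<in>F'. x \<notin> U" for x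
    using that F'(3) unfolding rv_support_def by blast
  ultimately show ?thesis
    by (auto elim: eventually_mono)
qed

section \<open>Independence and Fubini\<close>

lemma (in prob_space) indep_rv_distr_pair:
  fixes X :: "'a \<Rightarrow> 'x::second_countable_topology" and Y :: "'a \<Rightarrow> 'y::second_countable_topology"
  assumes X[measurable]: "X \<in> borel_measurable M" and Y[measurable]: "Y \<in> borel_measurable M"
    and ind: "indep_rv M Y X"
  shows "distr M borel X \<Otimes>\<^sub>M distr M borel Y = distr M (borel \<Otimes>\<^sub>M borel) (\<lambda>s. (X s, Y s))"
proof -
  interpret DX: prob_space "distr M borel X" by (rule prob_space_distr) simp
  interpret DY: prob_space "distr M borel Y" by (rule prob_space_distr) simp
  show ?thesis
  \<comment> \<open>For sigma-finite factors it is enough to compare the two measures on measurable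
    rectangles, and there independence factors the probability.\<close>
  proof (rule pair_measure_eqI)
    fix A B assume "A \<in> sets (distr M borel X)" "B \<in> sets (distr M borel Y)"
    then have AB[measurable]: "A \<in> sets borel" "B \<in> sets borel" by auto
    have "Y -` B \<inter> space M \<in> sets (vimage_algebra (space M) Y borel)"
      "X -` A \<inter> space M \<in> sets (vimage_algebra (space M) X borel)"
      by (auto intro: in_vimage_algebra)
    then have "prob ((Y -` B \<inter> space M) \<inter> (X -` A \<inter> space M))
        = prob (Y -` B \<inter> space M) * prob (X -` A \<inter> space M)"
      using ind unfolding indep_rv_def by (intro indep_setD)
    moreover have "(\<lambda>s. (X s, Y s)) -` (A \<times> B) \<inter> space M
        = (Y -` B \<inter> space M) \<inter> (X -` A \<inter> space M)"
      by auto
    ultimately show "emeasure (distr M borel X) A * emeasure (distr M borel Y) B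
        = emeasure (distr M (borel \<Otimes>\<^sub>M borel) (\<lambda>s. (X s, Y s))) (A \<times> B)"
      by (simp add: emeasure_distr emeasure_eq_measure ennreal_mult[symmetric] mult.commute)
  qed (auto intro: DX.sigma_finite_measure_axioms DY.sigma_finite_measure_axioms cong: sets_pair_measure_cong)
qed

text \<open>Under independence the joint law is a product, so Fubini integrates \<open>Y\<close> out
  first and leaves the probability of a section of \<open>B\<close>. The functions \<open>f\<close>
  and \<open>h\<close> are separate because the outcome difference need not be a function of
  \<omega>: both are read off one vector \<open>X\<close>, and it is that vector which is
  independent of \<open>Y\<close>.\<close>

lemma (in prob_space) integral_indep_section:
  fixes X :: "'a \<Rightarrow> 'x::second_countable_topology" and Y :: "'a \<Rightarrow> 'y::second_countable_topology"
    and f :: "'x \<Rightarrow> real" and h :: "'x \<Rightarrow> 'w::second_countable_topology"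
  assumes X[measurable]: "X \<in> borel_measurable M" and Y[measurable]: "Y \<in> borel_measurable M"
    and ind: "indep_rv M Y X"
    and f[measurable]: "f \<in> borel_measurable borel" and int: "integrable M (\<lambda>s. f (X s))"
    and h[measurable]: "h \<in> borel_measurable borel" and B: "B \<in> sets borel"
  shows "(LINT s|M. f (X s) * indicator B (h (X s), Y s))
    = (LINT s|M. f (X s) * measure (distr M borel Y) (Pair (h (X s)) -` B))"
proof -
  interpret DX: prob_space "distr M borel X" by (rule prob_space_distr) simp
  interpret DY: prob_space "distr M borel Y" by (rule prob_space_distr) simp
  interpret P: pair_prob_space "distr M borel X" "distr M borel Y" ..
  have B'[measurable]: "B \<in> sets (borel \<Otimes>\<^sub>M borel)"
    using B unfolding borel_prod .
  let ?k = "\<lambda>p. f (fst p) * indicator B (h (fst p), snd p) :: real"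
  have k[measurable]: "?k \<in> borel_measurable (borel \<Otimes>\<^sub>M borel)"
    by measurable
  note eq = indep_rv_distr_pair[OF X Y ind]
  have "integrable M (\<lambda>s. f (X s) * indicator B (h (X s), Y s))"
    by (rule Bochner_Integration.integrable_bound[OF int]) (auto simp: indicator_def)
  then have ik: "integrable (distr M borel X \<Otimes>\<^sub>M distr M borel Y) ?k"
    unfolding eq by (subst integrable_distr_eq) auto
  have "(LINT s|M. f (X s) * indicator B (h (X s), Y s))
      = integral\<^sup>L (distr M borel X \<Otimes>\<^sub>M distr M borel Y) ?k"
    unfolding eq by (subst integral_distr) auto
  also have "\<dots> = (LINT x|distr M borel X. LINT y|distr M borel Y. ?k (x, y))"
    using P.integral_fst'[OF ik] by simp
  also have "\<dots> = (LINT x|distr M borel X. f x * measure (distr M borel Y) (Pair (h x) -` B))"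
  proof (rule Bochner_Integration.integral_cong[OF refl])
    fix x
    have "indicator B (h x, y) = (indicator (Pair (h x) -` B) y :: real)" for y
      by (simp add: indicator_def)
    then show "(LINT y|distr M borel Y. ?k (x, y)) = f x * measure (distr M borel Y) (Pair (h x) -` B)"
      by simp
  qed
  also have "\<dots> = (LINT s|M. f (X s) * measure (distr M borel Y) (Pair (h (X s)) -` B))"
    by (subst integral_distr) (auto intro!: borel_measurable_times measurable_compose[OF h DY.measurable_emeasure_Pair] simp: measure_def)
  finally show ?thesis .
qed

section \<open>Parallel trends as a moment condition\<close>

lemma (in prob_space) parallel_trends_iff:
  assumes int: "integrable M Y1" "integrable M Y2"
    and A: "{s \<in> space M. G s = 1} \<in> sets M"
    and G: "\<And>s. s \<in> space M \<Longrightarrow> G s \<in> {0, 1}"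
    and p: "prob {s \<in> space M. G s = 1} \<in> {0<..<1}"
  shows "parallel_trends M Y1 Y2 G \<longleftrightarrow>
    (LINT s|M. (demean M Y2 s - demean M Y1 s) * indicator {s \<in> space M. G s = 1} s) = 0"
proof -
  define A where "A = {s \<in> space M. G s = 1}"
  define d where "d = (\<lambda>s. Y2 s - Y1 s)"
  have Am[measurable]: "A \<in> sets M" and p': "0 < prob A" "prob A < 1"
    using A p by (auto simp: A_def)
  have compl: "{s \<in> space M. G s = 0} = space M - A"
    using G by (force simp: A_def)
  have d: "integrable M d" "integrable M (\<lambda>s. d s * indicator A s)"
    using int by (auto simp: d_def intro!: integrable_real_mult_indicator)
  have 1: "(LINT s:A|M. d s) = (LINT s|M. d s * indicator A s)"
    by (simp add: set_lebesgue_integral_def mult.commute)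
  have "(LINT s:(space M - A)|M. d s) = (LINT s|M. d s - d s * indicator A s)"
    unfolding set_lebesgue_integral_def
    by (rule Bochner_Integration.integral_cong) (auto simp: indicator_def)
  also have "\<dots> = (LINT s|M. d s) - (LINT s|M. d s * indicator A s)"
    using d by simp
  finally have 0: "(LINT s:(space M - A)|M. d s) = \<dots>" .
  have "(LINT s|M. (demean M Y2 s - demean M Y1 s) * indicator A s)
      = (LINT s|M. d s * indicator A s - (LINT r|M. d r) * indicator A s)"
    using int by (intro Bochner_Integration.integral_cong) (auto simp: demean_def d_def indicator_def)
  also have "\<dots> = (LINT s|M. d s * indicator A s) - (LINT s|M. d s) * prob A"
    by (subst Bochner_Integration.integral_diff) (auto simp: d emeasure_eq_measure)
  finally have D: "(LINT s|M. (demean M Y2 s - demean M Y1 s) * indicator A s) = \<dots>" .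
  \<comment> \<open>Write p for \<open>prob A\<close> and m for the integral of \<open>d\<close>
    over \<open>A\<close>. Parallel trends reads m / p = (E d - m) / (1 - p). As both denominators
    are nonzero, this is m = p * E d, and by \<open>D\<close> the demeaned moment is exactly m - p *
    E d.\<close>
  show ?thesis
    unfolding parallel_trends_def cond_exp_event_def compl A_def[symmetric] D d_def[symmetric] 1 0
    using p' by (simp add: prob_compl field_simps)
qed

section \<open>The equivalence\<close>

theorem theorem3p1:
  fixes M :: "'s measure"
    and \<alpha> :: "'s \<Rightarrow> 'a::euclidean_space"
    and \<epsilon>1 :: "'s \<Rightarrow> 'e1::euclidean_space"
    and \<epsilon>2 :: "'s \<Rightarrow> 'e2::euclidean_space"
    and \<mu> :: "'s \<Rightarrow> 'm::euclidean_space"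
    and \<eta>1 :: "'s \<Rightarrow> 'h1::euclidean_space"
    and \<eta>2 :: "'s \<Rightarrow> 'h2::euclidean_space"
    and \<nu> :: "'s \<Rightarrow> real"
    and \<xi>1 :: "'a \<times> 'e1 \<Rightarrow> real"
    and \<xi>2 :: "'a \<times> 'e2 \<Rightarrow> real"
    and h :: "'a \<times> 'e1 \<times> 'e2 \<times> 'm \<times> 'h1 \<times> 'h2 \<Rightarrow> 'w::euclidean_space"
    and \<omega> :: "'s \<Rightarrow> 'w"
    and Y1 Y2 :: "'s \<Rightarrow> real"
  assumes "prob_space M"
    and "\<alpha> \<in> borel_measurable M"
    and "\<epsilon>1 \<in> borel_measurable M" and "\<epsilon>2 \<in> borel_measurable M"
    and "\<mu> \<in> borel_measurable M"
    and "\<eta>1 \<in> borel_measurable M" and "\<eta>2 \<in> borel_measurable M"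
    and "\<nu> \<in> borel_measurable M"
    and "\<xi>1 \<in> borel_measurable borel" and "\<xi>2 \<in> borel_measurable borel"
    and "h \<in> borel_measurable borel"
    and Y1: "Y1 = (\<lambda>s. \<xi>1 (\<alpha> s, \<epsilon>1 s))"
    and Y2: "Y2 = (\<lambda>s. \<xi>2 (\<alpha> s, \<epsilon>2 s))"
    and "integrable M Y1" and "integrable M Y2"
    and omega: "\<omega> = (\<lambda>s. h (\<alpha> s, \<epsilon>1 s, \<epsilon>2 s, \<mu> s, \<eta>1 s, \<eta>2 s))"
    and "\<exists>c. measure M {s \<in> space M. \<nu> s > c} \<in> {0<..<1}"
    and "indep_rv M \<nu> (\<lambda>s. (\<alpha> s, \<epsilon>1 s, \<epsilon>2 s, \<mu> s, \<eta>1 s, \<eta>2 s))"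
    and "measure M {s \<in> space M. cond_exp_given M \<omega> (\<lambda>r. demean M Y2 r - demean M Y1 r) s > 0} < 1
       \<or> measure M {s \<in> space M. cond_exp_given M \<omega> (\<lambda>r. demean M Y2 r - demean M Y1 r) s < 0} < 1"
  shows "(\<forall>g \<in> selection_mechanisms (rv_support M \<omega>) (rv_support M \<nu>).
            measure M {s \<in> space M. group_indicator M \<omega> \<nu> g s = 1} \<in> {0<..<1} \<longrightarrow>
            parallel_trends M Y1 Y2 (group_indicator M \<omega> \<nu> g))
     \<longleftrightarrow> (AE s in M. cond_exp_given M \<omega> (\<lambda>r. demean M Y2 r - demean M Y1 r) s = 0)"
proof -
  interpret prob_space M by fact
  note [measurable] = assms(2-11)
  \<comment> \<open>Independence of \<nu> is available for the whole vector \<open>V\<close>, so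
    \<omega> and \<open>D\<close> are both written as Borel functions of it, through
    \<open>h\<close> and \<open>f\<close>.\<close>
  define V where "V = (\<lambda>s. (\<alpha> s, \<epsilon>1 s, \<epsilon>2 s, \<mu> s, \<eta>1 s, \<eta>2 s))"
  define D where "D = (\<lambda>r. demean M Y2 r - demean M Y1 r)"
  define f where "f = (\<lambda>(a, e1, e2, m :: 'm, h1 :: 'h1, h2 :: 'h2).
    \<xi>2 (a, e2) - (LINT r|M. Y2 r) - (\<xi>1 (a, e1) - (LINT r|M. Y1 r)))"
  define F where "F = vimage_algebra (space M) \<omega> borel"
  have V[measurable]: "V \<in> borel_measurable M"
    unfolding V_def by measurable
  have f[measurable]: "f \<in> borel_measurable borel"
    unfolding f_def borel_prod[symmetric] by measurable
  have \<omega>V: "\<omega> s = h (V s)" and DV: "D s = f (V s)" for s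
    by (simp_all add: omega V_def D_def f_def demean_def Y1 Y2)
  have \<omega>[measurable]: "\<omega> \<in> borel_measurable M"
    unfolding \<omega>V[abs_def] by measurable
  have ind: "indep_rv M \<nu> V"
    using assms by (simp add: V_def)
  have intY: "integrable M Y1" "integrable M Y2" by fact+
  then have D: "integrable M D"
    by (auto simp: D_def demean_def)
  then have fV: "integrable M (\<lambda>s. f (V s))"
    by (simp flip: DV)
  have sub: "subalgebra M F"
    unfolding subalgebra_def F_def using \<omega> by (auto simp: sets_vimage_algebra2)
  interpret F: finite_measure_subalgebra M F
    by unfold_locales (fact sub)
  let ?S = "rv_support M \<omega> \<times> rv_support M \<nu>"
  have S: "?S \<in> sets borel"
    by (intro borel_closed closed_Times closed_rv_support)
  let ?G = "group_indicator M \<omega> \<nu>"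
  \<comment> \<open>The set \<open>B\<close> is the preimage of 1 intersected with the product of
    the supports. That product is closed, so \<open>B\<close> is Borel in the full space and not
    only relative to the supports. The default 0 off the supports makes the equivalence hold at
    every point.\<close>
  have G: "{s \<in> space M. ?G g s = 1} \<in> sets M \<and> (\<forall>s. ?G g s \<in> {0, 1})
      \<and> (\<exists>B \<in> sets borel. \<forall>s. ?G g s = 1 \<longleftrightarrow> (\<omega> s, \<nu> s) \<in> B)"
    if g: "g \<in> selection_mechanisms (rv_support M \<omega>) (rv_support M \<nu>)" for g
  proof -
    let ?B = "g -` {1} \<inter> ?S"
    have g': "g \<in> measurable (restrict_space borel ?S) (count_space {0, 1})"
      using g by (simp add: selection_mechanisms_def)
    have "?B \<in> sets (restrict_space borel ?S)"
      using measurable_sets[OF g', of "{1}"] by (simp add: space_restrict_space)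
    then have B: "?B \<in> sets borel"
      using S by (subst (asm) sets_restrict_space_iff) auto
    have gB: "?G g s = 1 \<longleftrightarrow> (\<omega> s, \<nu> s) \<in> ?B" for s
      by (auto simp: group_indicator_def)
    have "{s \<in> space M. ?G g s = 1} = (\<lambda>s. (\<omega> s, \<nu> s)) -` ?B \<inter> space M"
      using gB by blast
    also have "\<dots> \<in> sets M"
      by (rule measurable_sets[OF _ B]) measurable
    finally have "{s \<in> space M. ?G g s = 1} \<in> sets M" .
    moreover have "?G g s \<in> {0, 1}" for s
      using measurable_space[OF g', of "(\<omega> s, \<nu> s)"]
      by (auto simp: group_indicator_def space_restrict_space)
    ultimately show ?thesis
      using B gB by blast
  qed
  have PT: "parallel_trends M Y1 Y2 (?G g) \<longleftrightarrow>
      (LINT s|M. D s * indicator {s \<in> space M. ?G g s = 1} s) = 0"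
    if "g \<in> selection_mechanisms (rv_support M \<omega>) (rv_support M \<nu>)"
      "prob {s \<in> space M. ?G g s = 1} \<in> {0<..<1}" for g
    unfolding D_def using G[OF that(1)] that(2) by (intro parallel_trends_iff intY) auto
  show ?thesis
    unfolding cond_exp_given_def D_def[symmetric] F_def[symmetric]
  proof
    assume Z: "AE s in M. real_cond_exp M F D s = 0"
    show "\<forall>g\<in>selection_mechanisms (rv_support M \<omega>) (rv_support M \<nu>).
      prob {s \<in> space M. ?G g s = 1} \<in> {0<..<1} \<longrightarrow> parallel_trends M Y1 Y2 (?G g)"
    proof (intro ballI impI)
      fix g assume g: "g \<in> selection_mechanisms (rv_support M \<omega>) (rv_support M \<nu>)"
        and p: "prob {s \<in> space M. ?G g s = 1} \<in> {0<..<1}"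
      obtain B where B: "B \<in> sets borel" "\<And>s. ?G g s = 1 \<longleftrightarrow> (\<omega> s, \<nu> s) \<in> B"
        using G[OF g] by blast
      \<comment> \<open>By independence, \<open>\<phi> w\<close> is the probability of treatment
        given that \<omega> equals \<open>w\<close>.\<close>
      define \<phi> where "\<phi> = (\<lambda>w. measure (distr M borel \<nu>) (Pair w -` B))"
      interpret N: prob_space "distr M borel \<nu>" by (rule prob_space_distr) simp
      have "B \<in> sets (borel \<Otimes>\<^sub>M distr M borel \<nu>)"
        using B(1) by (simp flip: borel_prod cong: sets_pair_measure_cong)
      then have [measurable]: "\<phi> \<in> borel_measurable borel"
        unfolding \<phi>_def measure_def
        by (intro borel_measurable_enn2real N.measurable_emeasure_Pair)
      have \<omega>F: "\<omega> \<in> measurable F borel"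
        unfolding F_def by (rule measurable_vimage_algebra1) auto
      have \<phi>F: "(\<lambda>s. \<phi> (\<omega> s)) \<in> borel_measurable F"
        by (rule measurable_compose[OF \<omega>F]) measurable
      have \<phi>1: "\<bar>\<phi> w\<bar> \<le> 1" for w
        by (simp add: \<phi>_def N.prob_le_1)
      have i: "integrable M (\<lambda>s. \<phi> (\<omega> s) * D s)"
        by (rule Bochner_Integration.integrable_bound[OF D])
          (use D in \<open>auto simp: abs_mult \<phi>1 intro!: mult_left_le_one_le\<close>)
      have "(LINT s|M. D s * indicator {s \<in> space M. ?G g s = 1} s)
          = (LINT s|M. f (V s) * indicator B (h (V s), \<nu> s))"
        by (intro Bochner_Integration.integral_cong) (auto simp: B(2)[unfolded One_nat_def] DV \<omega>V indicator_def)
      also have "\<dots> = (LINT s|M. \<phi> (\<omega> s) * D s)"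
        by (subst integral_indep_section[OF V _ ind f fV _ B(1)]) (auto simp: \<phi>_def DV \<omega>V mult.commute)
      \<comment> \<open>The weight \<open>\<phi> (\<omega> s)\<close> is bounded and
        \<open>F\<close>-measurable, so \<open>D\<close> may be replaced by its conditional
        expectation under the integral.\<close>
      also have "\<dots> = (LINT s|M. \<phi> (\<omega> s) * real_cond_exp M F D s)"
        using F.real_cond_exp_intg(2)[OF i \<phi>F] D by auto
      also have "\<dots> = (LINT s|M. 0)"
        using Z by (intro integral_cong_AE) (auto intro: borel_measurable_cond_exp2)
      finally show "parallel_trends M Y1 Y2 (?G g)"
        using PT[OF g p] by simp
    qed
  next
    assume pt: "\<forall>g\<in>selection_mechanisms (rv_support M \<omega>) (rv_support M \<nu>).
      prob {s \<in> space M. ?G g s = 1} \<in> {0<..<1} \<longrightarrow> parallel_trends M Y1 Y2 (?G g)"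
    obtain c where c: "prob {s \<in> space M. \<nu> s > c} \<in> {0<..<1}"
      using assms by blast
    show "AE s in M. real_cond_exp M F D s = 0"
    \<comment> \<open>Zero is a version of the conditional expectation once \<open>D\<close>
      integrates to 0 over every set of \<open>F\<close>, that is, over every preimage of a Borel
      set under \<omega>.\<close>
    proof (rule F.real_cond_exp_charact)
      fix T assume "T \<in> sets F"
      then obtain A where A[measurable]: "A \<in> sets borel" and T: "T = \<omega> -` A \<inter> space M"
        unfolding F_def by (auto simp: sets_vimage_algebra2)
      \<comment> \<open>Treating on \<omega> in \<open>A\<close> alone would give a degenerate group
        when \<open>A\<close> has probability one. Requiring also \<nu> > \<open>c\<close> scales
        the treatment probability by \<open>q\<close> < 1, and by independence it scales the moment
        of \<open>D\<close> by the same factor.\<close>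
      define B where "B = A \<times> {c<..}"
      define g where "g = (\<lambda>p. if p \<in> B then 1 else 0 :: nat)"
      define q where "q = prob {s \<in> space M. \<nu> s > c}"
      have B[measurable]: "B \<in> sets borel"
        unfolding B_def borel_prod[symmetric] by measurable
      have "g \<in> measurable borel (count_space {0, 1})"
        unfolding g_def by measurable
      then have g: "g \<in> selection_mechanisms (rv_support M \<omega>) (rv_support M \<nu>)"
        unfolding selection_mechanisms_def by (rule measurable_restrict_space1)
      have [measurable]: "{s \<in> space M. ?G g s = 1} \<in> sets M"
        using G[OF g] by blast
      \<comment> \<open>Only almost sure equality can be claimed: \<open>B\<close> may leave the
        product of the supports, where the indicator defaults to 0.\<close>
      have GB: "AE s in M. indicator {s \<in> space M. ?G g s = 1} s = (indicator B (\<omega> s, \<nu> s) :: real)"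
        using AE_rv_support[OF \<omega>] AE_rv_support[OF assms(8)] AE_space
        by eventually_elim (auto simp: group_indicator_def g_def indicator_def)
      have sec: "measure (distr M borel \<nu>) (Pair w -` B) = indicator A w * q" for w
      proof -
        have "Pair w -` B = (if w \<in> A then {c<..} else {})"
          by (auto simp: B_def)
        moreover have "\<nu> -` {c<..} \<inter> space M = {s \<in> space M. \<nu> s > c}"
          by auto
        ultimately show ?thesis
          by (simp add: q_def measure_distr)
      qed
      \<comment> \<open>A general \<open>k\<close> serves two purposes: the constant 1 yields the
        treatment probability, and \<open>f\<close> yields the moment of \<open>D\<close>.\<close>
      have key: "(LINT s|M. k (V s) * indicator {s \<in> space M. ?G g s = 1} s)
          = q * (LINT s|M. indicator T s * k (V s))"
        if k[measurable]: "k \<in> borel_measurable borel" and "integrable M (\<lambda>s. k (V s))" for k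
      proof -
        have "(LINT s|M. k (V s) * indicator {s \<in> space M. ?G g s = 1} s)
            = (LINT s|M. k (V s) * indicator B (h (V s), \<nu> s))"
        proof (rule integral_cong_AE)
          show "AE s in M. k (V s) * indicator {s \<in> space M. ?G g s = 1} s
              = k (V s) * indicator B (h (V s), \<nu> s)"
            using GB by eventually_elim (simp add: \<omega>V)
        qed measurable
        also have "\<dots> = (LINT s|M. k (V s) * (indicator A (\<omega> s) * q))"
          by (subst integral_indep_section[OF V _ ind that]) (auto simp: sec \<omega>V)
        also have "\<dots> = (LINT s|M. q * (indicator T s * k (V s)))"
          by (intro Bochner_Integration.integral_cong) (auto simp: T indicator_def)
        finally show ?thesis by simp
      qed
      have Tm[measurable]: "T \<in> sets M"
        unfolding T by measurable
      have q: "0 < q" "q < 1"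
        using c by (auto simp: q_def)
      have pG: "prob {s \<in> space M. ?G g s = 1} = q * prob T"
      proof -
        have "(LINT s|M. 1 * indicator {s \<in> space M. ?G g s = 1} s) = q * (LINT s|M. indicator T s * 1)"
          by (rule key) simp_all
        then show ?thesis
          by (simp only: mult_1_left mult_1_right Bochner_Integration.integral_indicator)
            (simp add: T Int_def conj_commute)
      qed
      have "(LINT s|M. indicator T s * D s) = 0"
      \<comment> \<open>If \<open>T\<close> is null the group is degenerate and parallel trends says
        nothing, but the integral over \<open>T\<close> vanishes anyway. Otherwise the group
        probability \<open>q * prob T\<close> lies strictly between 0 and 1, and the factor
        \<open>q\<close> > 0 cancels from the moment condition.\<close>
      proof (cases "prob T = 0")
        case True
        then have "AE s in M. s \<notin> T"
          by (simp add: prob_eq_0)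
        then have "(LINT s|M. indicator T s * D s) = (LINT s|M. 0)"
          using D by (intro integral_cong_AE) auto
        then show ?thesis by simp
      next
        case False
        then have "0 < prob T"
          by (simp add: zero_less_measure_iff)
        moreover have "q * prob T < 1"
          using q mult_left_le[OF prob_le_1[of T], of q] by linarith
        ultimately have "prob {s \<in> space M. ?G g s = 1} \<in> {0<..<1}"
          unfolding pG using q by auto
        then have "(LINT s|M. D s * indicator {s \<in> space M. ?G g s = 1} s) = 0"
          using pt g PT[OF g] by blast
        then show ?thesis
          using key[OF f fV] q by (simp add: DV)
      qed
      then show "(LINT s:T|M. D s) = (LINT s:T|M. 0)"
        by (simp add: set_lebesgue_integral_def)
    qed (use D in auto)
  qed
qed

end
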